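(* Let $G$ be a connected $k$-regular graph on $n$ vertices and let $G'$ be a $(k+1)$-regular graph on the same vertex set containing $G$ as a subgraph. Let $H$ be a connected graph with at least two vertices and diameter $D_H$. Then $$\frac{k}{k+1}\le \frac{\lambda(G',H)}{\lambda(G,H)}\le \frac{k}{k+1}\left(1+\frac{nD_H^2}{2}\right).$$
   Context: All graphs are finite and simple. For a graph $G$, $d_v$ denotes the degree of $v$, $u\sim v$ means adjacency, and $\mathrm{vol}(G)=\sum_v d_v$. For a metric space $(X,d)$ and $f:V(G)\to X$ set $R_f(G,X)=\frac{\mathrm{vol}(G)\sum_{u\sim v} d(f(u),f(v))^2}{\sum_{u,v} d(f(u),f(v))^2 d_u d_v}$, where the numerator sum is over edges of $G$ and the denominator sum over unordered pairs of vertices; $\lambda(G,X)=\inf_f R_f(G,X)$ over all $f$ with nonzero denominator. A connected graph $H$ is regarded as the metric space $(V(H),d_H)$ with shortest-path distance, and $\lambda(G,H)=\lambda(G,(V(H),d_H))$. *)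

theory Defs
  imports "HOL-Analysis.Abstract_Metric_Spaces" "Graph_Theory.Graph_Theory"
begin

text \<open>
  Finite simple graphs are those of the locale \<^locale>\<open>graph\<close>: finite, loop-free, symmetric
  digraphs without parallel arcs.  Each edge is a pair of opposite arcs, so the degree of a vertex
  is its out-degree and a sum over edges is half the corresponding sum over arcs.
  \<^const>\<open>Digraph_Component.connected\<close> includes that the graph has a vertex.
\<close>

definition regular_graph :: "nat \<Rightarrow> ('a, 'e) pre_digraph \<Rightarrow> bool" where
  "regular_graph k G \<longleftrightarrow> (\<forall>v\<in>verts G. out_degree G v = k)"

definition vol :: "('a, 'e) pre_digraph \<Rightarrow> nat" where
  "vol G = (\<Sum>v\<in>verts G. out_degree G v)"

definition edge_energy :: "('a, 'e) pre_digraph \<Rightarrow> 'x metric \<Rightarrow> ('a \<Rightarrow> 'x) \<Rightarrow> real" where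
  "edge_energy G X f = (\<Sum>e\<in>arcs G. (mdist X (f (tail G e)) (f (head G e)))\<^sup>2) / 2"

text \<open>
  A sum over unordered pairs of vertices; half the sum over ordered pairs, the diagonal terms
  being zero.
\<close>

definition pair_energy :: "('a, 'e) pre_digraph \<Rightarrow> 'x metric \<Rightarrow> ('a \<Rightarrow> 'x) \<Rightarrow> real" where
  "pair_energy G X f =
     (\<Sum>u\<in>verts G. \<Sum>v\<in>verts G.
        (mdist X (f u) (f v))\<^sup>2 * real (out_degree G u) * real (out_degree G v)) / 2"

definition rayleigh :: "('a, 'e) pre_digraph \<Rightarrow> 'x metric \<Rightarrow> ('a \<Rightarrow> 'x) \<Rightarrow> real" where
  "rayleigh G X f = real (vol G) * edge_energy G X f / pair_energy G X f"

text \<open>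
  The real infimum: quotients are nonnegative, so the set is bounded below; its value is meaningful
  only if some admissible map exists.
\<close>

definition spectral_gap :: "('a, 'e) pre_digraph \<Rightarrow> 'x metric \<Rightarrow> real" where
  "spectral_gap G X = (INF f\<in>{f \<in> verts G \<rightarrow> mspace X. pair_energy G X f \<noteq> 0}. rayleigh G X f)"

text \<open>\<open>wf_digraph.\<mu> H c u v\<close> is the least cost of a walk from \<open>u\<close> to \<open>v\<close> for arc costs \<open>c\<close>.\<close>

definition graph_dist :: "('b, 'h) pre_digraph \<Rightarrow> 'b \<Rightarrow> 'b \<Rightarrow> real" where
  "graph_dist H u v = real_of_ereal (wf_digraph.\<mu> H (\<lambda>_. 1) u v)"

definition graph_metric :: "('b, 'h) pre_digraph \<Rightarrow> 'b metric" where
  "graph_metric H = metric (verts H, graph_dist H)"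

definition graph_diameter :: "('b, 'h) pre_digraph \<Rightarrow> real" where
  "graph_diameter H = Max {graph_dist H u v | u v. u \<in> verts H \<and> v \<in> verts H}"

text \<open>
  The map \<^const>\<open>metric\<close> is specified only on metric spaces, so the definition of
  \<^const>\<open>graph_metric\<close> needs the metric axioms, proved below for connected graphs.
\<close>

context graph
begin

lemma unit_cost [simp]: "awalk_cost (\<lambda>_. 1) p = real (length p)"
  by (induct p) auto

lemma awalk_reverse:
  assumes "awalk u p v" shows "\<exists>q. awalk v q u \<and> length q = length p"
  using assms
proof (induct p arbitrary: u)
  case Nil then show ?case by (auto simp: awalk_Nil_iff)
next
  case (Cons e p)
  then have e: "e \<in> arcs G" "tail G e = u" and w: "awalk (head G e) p v"
    by (auto simp: awalk_Cons_iff)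
  from Cons.hyps[OF w] obtain q where q: "awalk v q (head G e)" "length q = length p" by blast
  have "(tail G e, head G e) \<in> arcs_ends G" using e by (auto simp: arcs_ends_conv)
  then have "(head G e, tail G e) \<in> arcs_ends G"
    using sym_arcs by (auto simp: symmetric_def dest: symD)
  then obtain e' where e': "e' \<in> arcs G" "tail G e' = head G e" "head G e' = u"
    using e by (auto simp: arcs_ends_conv)
  have "awalk (head G e) [e'] u" using e' by (auto simp: awalk_Cons_iff awalk_Nil_iff)
  with q have "awalk v (q @ [e']) u" by (blast intro: awalk_appendI)
  with q show ?case by (intro exI[of _ "q @ [e']"]) auto
qed

lemma unit_mu_commute: "\<mu> (\<lambda>_. 1) u v = \<mu> (\<lambda>_. 1) v u"
proof -
  have "\<mu> (\<lambda>_. 1) u v \<le> \<mu> (\<lambda>_. 1) v u" for u v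
    unfolding \<mu>_def
  proof (rule INF_mono)
    fix p assume "p \<in> {p. awalk v p u}"
    then obtain q where "awalk u q v" "length q = length p" using awalk_reverse by blast
    then show "\<exists>q\<in>{p. awalk u p v}. ereal (awalk_cost (\<lambda>_. 1) q) \<le> ereal (awalk_cost (\<lambda>_. 1) p)"
      by auto
  qed
  then show ?thesis by (simp add: antisym)
qed

lemma graph_dist_awalk:
  assumes "Digraph_Component.connected G" "u \<in> verts G" "v \<in> verts G"
  obtains p where "awalk u p v" "graph_dist G u v = real (length p)"
proof -
  have "u \<rightarrow>\<^sup>* v"
    using assms reachable_mk_symmetric_eq[OF sym_arcs]
    by (auto simp: Digraph_Component.connected_def strongly_connected_def)
  then obtain p where "apath u p v" "\<mu> (\<lambda>_. 1) u v = awalk_cost (\<lambda>_. 1) p"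
    using min_cost_awalk[of u v "\<lambda>_. 1"] by auto
  then show ?thesis by (intro that[of p]) (auto simp: graph_dist_def apath_def)
qed

lemma graph_dist_le:
  assumes "Digraph_Component.connected G" "awalk u p v"
  shows "graph_dist G u v \<le> real (length p)"
proof -
  have "0 \<le> \<mu> (\<lambda>_. 1) u v" unfolding \<mu>_def by (intro INF_greatest) auto
  moreover have "\<mu> (\<lambda>_. 1) u v \<le> ereal (real (length p))"
    using min_cost_le_walk_cost[OF assms(2), of "\<lambda>_. 1"] by simp
  ultimately show ?thesis by (cases "\<mu> (\<lambda>_. 1) u v") (auto simp: graph_dist_def)
qed

lemma Metric_space_graph_dist:
  assumes "Digraph_Component.connected G"
  shows "Metric_space (verts G) (graph_dist G)"
proof
  fix u v
  have "0 \<le> \<mu> (\<lambda>_. 1) u v" unfolding \<mu>_def by (intro INF_greatest) auto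
  then show "0 \<le> graph_dist G u v" by (simp add: graph_dist_def real_of_ereal_pos)
  show "graph_dist G u v = graph_dist G v u" by (simp add: graph_dist_def unit_mu_commute)
next
  fix u v assume uv: "u \<in> verts G" "v \<in> verts G"
  from graph_dist_awalk[OF assms uv] obtain p
    where p: "awalk u p v" "graph_dist G u v = real (length p)" .
  show "graph_dist G u v = 0 \<longleftrightarrow> u = v"
  proof
    assume "graph_dist G u v = 0"
    with p show "u = v" by (auto simp: awalk_Nil_iff)
  next
    assume "u = v"
    then have "awalk u [] v" using uv by (auto simp: awalk_Nil_iff)
    from graph_dist_le[OF assms this] p show "graph_dist G u v = 0" by auto
  qed
  fix w assume w: "w \<in> verts G"
  from graph_dist_awalk[OF assms uv(2) w] obtain q
    where q: "awalk v q w" "graph_dist G v w = real (length q)" .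
  have "awalk u (p @ q) w" using p q by (blast intro: awalk_appendI)
  from graph_dist_le[OF assms this] p q
  show "graph_dist G u w \<le> graph_dist G u v + graph_dist G v w" by simp
qed

end

lemma
  assumes "graph H" "Digraph_Component.connected H"
  shows mspace_graph_metric: "mspace (graph_metric H) = verts H"
    and mdist_graph_metric: "mdist (graph_metric H) = graph_dist H"
  using graph.Metric_space_graph_dist[OF assms]
  by (simp_all add: graph_metric_def Metric_space.mspace_metric Metric_space.mdist_metric)

end

theory Submission
  imports Defs
begin

text \<open>
  For a \<open>k\<close>-regular graph on \<open>n\<close> vertices the Rayleigh quotient is \<open>n E / (k P)\<close>, where \<open>E\<close> is the
  edge energy and \<open>P\<close> is the sum of the squared distances over the unordered pairs; \<open>P\<close> depends on the
  vertex set only.  So for each map the quotients of \<open>G'\<close> and \<open>G\<close> have ratio \<open>k E' / ((k + 1) E)\<close>.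
  Adding edges gives \<open>E \<le> E'\<close>.  The \<open>n / 2\<close> added edges contribute at most \<open>n D\<^sup>2 / 2\<close> to \<open>E'\<close>, and
  \<open>E \<ge> 1\<close> because distances in \<open>H\<close> are integers and a nonconstant map separates the ends of some
  edge; hence \<open>E' \<le> (1 + n D\<^sup>2 / 2) E\<close>.  Both bounds pass to the infimum.
\<close>

section \<open>Rayleigh quotients of regular graphs, and elementary properties of the
  infimum\<close>

lemma vol_regular:
  assumes "regular_graph k G"
  shows "vol G = card (verts G) * k"
  using assms by (simp add: vol_def regular_graph_def)

lemma pair_energy_regular:
  assumes "regular_graph k G"
  shows "pair_energy G X f =
    (real k)\<^sup>2 * ((\<Sum>u\<in>verts G. \<Sum>v\<in>verts G. (mdist X (f u) (f v))\<^sup>2) / 2)"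
proof -
  have "(\<Sum>u\<in>verts G. \<Sum>v\<in>verts G.
          (mdist X (f u) (f v))\<^sup>2 * real (out_degree G u) * real (out_degree G v))
      = (\<Sum>u\<in>verts G. \<Sum>v\<in>verts G. (real k)\<^sup>2 * (mdist X (f u) (f v))\<^sup>2)"
    using assms by (intro sum.cong refl) (simp add: regular_graph_def power2_eq_square)
  then show ?thesis
    by (simp add: pair_energy_def sum_distrib_left)
qed

lemma rayleigh_regular:
  assumes "regular_graph k G"
  shows "rayleigh G X f = real (card (verts G)) * edge_energy G X f /
    (real k * ((\<Sum>u\<in>verts G. \<Sum>v\<in>verts G. (mdist X (f u) (f v))\<^sup>2) / 2))"
  using assms
  by (simp add: rayleigh_def vol_regular pair_energy_regular power2_eq_square)

lemma edge_energy_nonneg: "0 \<le> edge_energy G X f"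
  by (simp add: edge_energy_def sum_nonneg)

lemma pair_energy_nonneg: "0 \<le> pair_energy G X f"
  by (simp add: pair_energy_def sum_nonneg)

lemma rayleigh_nonneg: "0 \<le> rayleigh G X f"
  by (simp add: rayleigh_def edge_energy_nonneg pair_energy_nonneg)

lemma bdd_below_rayleigh: "bdd_below (rayleigh G X ` F)"
  by (auto intro!: bdd_belowI[of _ 0] rayleigh_nonneg)

lemma spectral_gap_le_rayleigh:
  assumes "f \<in> verts G \<rightarrow> mspace X" "pair_energy G X f \<noteq> 0"
  shows "spectral_gap G X \<le> rayleigh G X f"
  unfolding spectral_gap_def using assms
  by (intro cINF_lower bdd_below_rayleigh) auto

text \<open>Every arc leaves exactly one vertex, so the sets \<open>out_arcs G v\<close> partition
  the arcs. This serves to count the arcs that \<open>G'\<close> adds to \<open>G\<close>.\<close>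

lemma (in fin_digraph) card_arcs_eq_vol: "card (arcs G) = vol G"
proof -
  have "arcs G = (\<Union>v\<in>verts G. out_arcs G v)" by auto
  moreover have "card (\<Union>v\<in>verts G. out_arcs G v) = (\<Sum>v\<in>verts G. card (out_arcs G v))"
    by (intro card_UN_disjoint) auto
  ultimately show ?thesis by (simp add: vol_def out_degree_def)
qed

section \<open>Upper and lower bounds on the edge energy\<close>

lemma edge_energy_mono:
  assumes "subgraph G G'" "finite (arcs G')"
  shows "edge_energy G X f \<le> edge_energy G' X f"
proof -
  have "(\<Sum>e\<in>arcs G. (mdist X (f (tail G e)) (f (head G e)))\<^sup>2)
      = (\<Sum>e\<in>arcs G. (mdist X (f (tail G' e)) (f (head G' e)))\<^sup>2)"
    using assms(1) by (simp add: subgraph_def compatible_def)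
  also have "\<dots> \<le> (\<Sum>e\<in>arcs G'. (mdist X (f (tail G' e)) (f (head G' e)))\<^sup>2)"
    using assms by (intro sum_mono2) (auto simp: subgraph_def)
  finally show ?thesis by (simp add: edge_energy_def)
qed

text \<open>Compatibility makes tails and heads agree on the common arcs, so only the added arcs
  cost anything. They are counted as arcs, twice per edge, hence the division by 2.\<close>

lemma edge_energy_le_add:
  assumes "subgraph G G'" "wf_digraph G'" "finite (arcs G')"
    and "\<And>u v. u \<in> verts G' \<Longrightarrow> v \<in> verts G' \<Longrightarrow> mdist X (f u) (f v) \<le> D"
  shows "edge_energy G' X f
    \<le> edge_energy G X f + real (card (arcs G' - arcs G)) * D\<^sup>2 / 2"
proof -
  let ?g = "\<lambda>e. (mdist X (f (tail G' e)) (f (head G' e)))\<^sup>2"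
  have "sum ?g (arcs G' - arcs G) \<le> real (card (arcs G' - arcs G)) * D\<^sup>2"
  proof (rule sum_bounded_above)
    fix e assume "e \<in> arcs G' - arcs G"
    then have "mdist X (f (tail G' e)) (f (head G' e)) \<le> D"
      using assms(2,4) by (simp add: wf_digraph_def)
    then show "?g e \<le> D\<^sup>2" by (intro power_mono) auto
  qed
  moreover have "sum ?g (arcs G') = sum ?g (arcs G' - arcs G) + sum ?g (arcs G)"
    using assms(1,3) by (intro sum.subset_diff) (auto simp: subgraph_def)
  moreover have "sum ?g (arcs G) = 2 * edge_energy G X f"
    using assms(1) by (simp add: edge_energy_def subgraph_def compatible_def)
  ultimately show ?thesis by (simp add: edge_energy_def)
qed

text \<open>If \<open>f\<close> took equal values at the ends of every arc, it would be constant
  along every walk, in particular along one from \<open>u\<close> to \<open>v\<close>.\<close>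

lemma (in graph) connected_separated_arc:
  assumes "Digraph_Component.connected G" "u \<in> verts G" "v \<in> verts G" "f u \<noteq> f v"
  obtains e where "e \<in> arcs G" "f (tail G e) \<noteq> f (head G e)"
proof -
  have "f u = f w" if "awalk u p w" "\<And>e. e \<in> arcs G \<Longrightarrow> f (tail G e) = f (head G e)" for p w
    using that by (induct p arbitrary: u) (auto simp: awalk_Nil_iff awalk_Cons_iff)
  moreover obtain p where "awalk u p v"
    using graph_dist_awalk[OF assms(1-3)] by blast
  ultimately show ?thesis using assms(4) that by blast
qed

text \<open>The separated edge contributes both of its arcs, which cancels the factor \<open>1 / 2\<close>.\<close>

lemma (in graph) edge_energy_ge:
  assumes "Digraph_Component.connected G" "u \<in> verts G" "v \<in> verts G" "f u \<noteq> f v"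
    and "0 \<le> c"
    and gap: "\<And>u v. u \<in> verts G \<Longrightarrow> v \<in> verts G \<Longrightarrow> f u \<noteq> f v \<Longrightarrow> c \<le> mdist X (f u) (f v)"
  shows "c\<^sup>2 \<le> edge_energy G X f"
proof -
  let ?g = "\<lambda>e. (mdist X (f (tail G e)) (f (head G e)))\<^sup>2"
  obtain e where e: "e \<in> arcs G" "f (tail G e) \<noteq> f (head G e)"
    using connected_separated_arc[OF assms(1-4)] .
  have "(head G e, tail G e) \<in> arcs_ends G"
    using in_arcs_imp_in_arcs_ends[OF e(1)] sym_arcs by (auto simp: symmetric_def dest: symD)
  then obtain e' where e': "e' \<in> arcs G" "tail G e' = head G e" "head G e' = tail G e"
    by (auto simp: arcs_ends_conv)
  \<comment> \<open>If the two arcs were equal, the ends of \<open>e\<close> would coincide and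
    \<open>f\<close> could not separate them.\<close>
  have "e \<noteq> e'" using e(2) e'(2) by metis
  have *: "c\<^sup>2 \<le> ?g a" if "a \<in> {e, e'}" for a
    using that e e' assms(5) by (intro power_mono gap) auto
  have "2 * c\<^sup>2 \<le> ?g e + ?g e'"
    using *[of e] *[of e'] by simp
  also have "\<dots> = sum ?g {e, e'}" using \<open>e \<noteq> e'\<close> by simp
  also have "\<dots> \<le> sum ?g (arcs G)" using e e' by (intro sum_mono2) auto
  finally show ?thesis by (simp add: edge_energy_def)
qed

section \<open>Distances in the target graph\<close>

lemma (in graph) graph_dist_ge_1:
  assumes "Digraph_Component.connected G" "u \<in> verts G" "v \<in> verts G" "u \<noteq> v"
  shows "1 \<le> graph_dist G u v"
proof -
  obtain p where p: "awalk u p v" "graph_dist G u v = real (length p)"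
    using graph_dist_awalk[OF assms(1-3)] .
  then have "p \<noteq> []" using assms(4) by (auto simp: awalk_Nil_iff)
  with p(2) show ?thesis by (simp add: Suc_leI)
qed

lemma graph_dist_le_diameter:
  assumes "finite (verts H)" "u \<in> verts H" "v \<in> verts H"
  shows "graph_dist H u v \<le> graph_diameter H"
proof -
  \<comment> \<open>As the image of a finite product the set is finite, so \<open>Max\<close> bounds
    its elements.\<close>
  have "{graph_dist H u v | u v. u \<in> verts H \<and> v \<in> verts H}
      = (\<lambda>(u, v). graph_dist H u v) ` (verts H \<times> verts H)"
    by auto
  then show ?thesis
    unfolding graph_diameter_def using assms by (intro Max_ge) auto
qed

theorem theorem6p7:
  fixes G G' :: "('a, 'e) pre_digraph" and H :: "('b, 'h) pre_digraph" and k n :: nat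
  assumes "graph G" and "Digraph_Component.connected G" and "regular_graph k G"
    and "card (verts G) = n"
    and "graph G'" and "regular_graph (k + 1) G'" and "spanning G G'"
    and "graph H" and "Digraph_Component.connected H" and "card (verts H) \<ge> 2"
  shows "real k / (real k + 1)
           \<le> spectral_gap G' (graph_metric H) / spectral_gap G (graph_metric H) \<and>
         spectral_gap G' (graph_metric H) / spectral_gap G (graph_metric H)
           \<le> real k / (real k + 1) * (1 + real n * (graph_diameter H)\<^sup>2 / 2)"
proof -
  interpret G: graph G by fact
  interpret G': graph G' by fact
  interpret H: graph H by fact
  let ?X = "graph_metric H" and ?D = "graph_diameter H"
  note mspace [simp] = mspace_graph_metric[OF assms(8,9)]
  note mdist = mdist_graph_metric[OF assms(8,9)]
  have sub: "subgraph G G'" and vG: "verts G' = verts G"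
    using assms(7) by (auto simp: spanning_def)

  \<comment> \<open>A second vertex, and positivity of the degree\<close>
  obtain v where v: "v \<in> verts G"
    using assms(2) by (auto simp: Digraph_Component.connected_def strongly_connected_def)
  \<comment> \<open>The degree \<open>k + 1\<close> is positive whatever \<open>k\<close> is, so
    \<open>v\<close> has an arc in \<open>G'\<close>, and loop-freeness makes its head a second
    vertex.\<close>
  have "out_degree G' v = k + 1"
    using v vG assms(6) by (simp add: regular_graph_def)
  then have "out_arcs G' v \<noteq> {}" by (auto simp: out_degree_def)
  then obtain e where e: "e \<in> arcs G'" "tail G' e = v" by (metis ex_in_conv in_out_arcs_conv)
  define w where "w = head G' e"
  have w: "w \<in> verts G" "w \<noteq> v"
    using G'.head_in_verts[OF e(1)] G'.no_loops[OF e(1)] e(2) vG by (auto simp: w_def)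
  have n: "n > 0" using v assms(4) by (auto simp: card_gt_0_iff)
  have k: "k > 0"
  proof -
    \<comment> \<open>The identity separates \<open>v\<close> from \<open>w\<close>, so the
      connected graph \<open>G\<close> has an arc, whose tail has positive degree.\<close>
    obtain a where a: "a \<in> arcs G"
      using G.connected_separated_arc[OF assms(2) v w(1), of id] w(2) by auto
    then have "0 < out_degree G (tail G a)"
      unfolding out_degree_def by (subst card_gt_0_iff) auto
    then show ?thesis
      using a assms(3) by (simp add: regular_graph_def)
  qed

  \<comment> \<open>Admissible maps and bounds on their energies\<close>
  define P where "P = (\<lambda>f. (\<Sum>u\<in>verts G. \<Sum>v\<in>verts G. (mdist ?X (f u) (f v))\<^sup>2) / 2)"
  define F where "F = {f \<in> verts G \<rightarrow> verts H. P f \<noteq> 0}"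
  have R: "rayleigh G ?X f = n * edge_energy G ?X f / (k * P f)" for f
    unfolding rayleigh_regular[OF assms(3)] P_def assms(4) ..
  have R': "rayleigh G' ?X f = n * edge_energy G' ?X f / ((k + 1) * P f)" for f
    unfolding rayleigh_regular[OF assms(6)] P_def vG assms(4) ..
  \<comment> \<open>The factors \<open>k^2\<close> and \<open>(k + 1)^2\<close> are nonzero, so both
    denominators vanish exactly when \<open>P\<close> does and both infima range over the same set
    \<open>F\<close>.\<close>
  have PE: "pair_energy G ?X f \<noteq> 0 \<longleftrightarrow> P f \<noteq> 0" for f
    unfolding pair_energy_regular[OF assms(3)] P_def using k by simp
  have PE': "pair_energy G' ?X f \<noteq> 0 \<longleftrightarrow> P f \<noteq> 0" for f
    unfolding pair_energy_regular[OF assms(6)] P_def vG by simp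
  have gap: "spectral_gap G ?X = (INF f\<in>F. rayleigh G ?X f)"
    unfolding spectral_gap_def F_def PE by simp
  have gap': "spectral_gap G' ?X = (INF f\<in>F. rayleigh G' ?X f)"
    unfolding spectral_gap_def F_def PE' by (simp add: vG)

  have Hdist: "1 \<le> mdist ?X x y" if "x \<in> verts H" "y \<in> verts H" "x \<noteq> y" for x y
    using H.graph_dist_ge_1[OF assms(9) that] by (simp add: mdist)
  have HD: "mdist ?X x y \<le> ?D" if "x \<in> verts H" "y \<in> verts H" for x y
    using graph_dist_le_diameter[OF _ that] by (simp add: mdist)

  obtain x y where xy: "x \<in> verts H" "y \<in> verts H" "x \<noteq> y"
    using assms(10) card_le_Suc0_iff_eq[OF H.finite_verts] by force
  have D: "1 \<le> ?D" using Hdist[OF xy] HD[OF xy(1,2)] by linarith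
  have "F \<noteq> {}"
  proof -
    \<comment> \<open>Singling out \<open>v\<close> puts \<open>v\<close> and \<open>w\<close> at
      distance at least 1, which keeps \<open>P f\<close> positive.\<close>
    define f where "f = (\<lambda>u. if u = v then x else y)"
    have "0 < (mdist ?X (f v) (f w))\<^sup>2"
      using Hdist[OF xy] w(2) by (simp add: f_def)
    also have "\<dots> \<le> (\<Sum>u\<in>verts G. (mdist ?X (f v) (f u))\<^sup>2)"
      using w(1) by (intro member_le_sum) auto
    also have "\<dots> \<le> (\<Sum>u'\<in>verts G. \<Sum>u\<in>verts G. (mdist ?X (f u') (f u))\<^sup>2)"
      using v by (intro member_le_sum[of v _ "\<lambda>u'. \<Sum>u\<in>verts G. (mdist ?X (f u') (f u))\<^sup>2"])
        (auto intro: sum_nonneg)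
    finally have "f \<in> F" using xy by (auto simp: F_def P_def f_def)
    then show ?thesis by blast
  qed

  have energy: "1 \<le> edge_energy G ?X f" and P_pos: "0 < P f"
    and P_le: "P f \<le> (real n)\<^sup>2 * ?D\<^sup>2 / 2" if f: "f \<in> F" for f
  proof -
    have fH: "f u \<in> verts H" if "u \<in> verts G" for u
      using f that by (auto simp: F_def)
    have "P f \<ge> 0" by (simp add: P_def sum_nonneg)
    then show "0 < P f" using f by (simp add: F_def)
    have "\<exists>u\<in>verts G. \<exists>v\<in>verts G. f u \<noteq> f v"
    proof (rule ccontr)
      assume "\<not> ?thesis"
      then have "mdist ?X (f u) (f v) = 0" if "u \<in> verts G" "v \<in> verts G" for u v
        using that fH[of v] by (metis mdist_zero mspace)
      then have "P f = 0" by (simp add: P_def)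
      with f show False by (simp add: F_def)
    qed
    then obtain u v where "u \<in> verts G" "v \<in> verts G" "f u \<noteq> f v" by blast
    from G.edge_energy_ge[OF assms(2) this, of 1 ?X] show "1 \<le> edge_energy G ?X f"
      using Hdist fH by simp
    \<comment> \<open>A crude bound over all ordered pairs, diagonal included; it only serves to
      keep the gap of \<open>G\<close> away from zero.\<close>
    have "(\<Sum>u\<in>verts G. \<Sum>v\<in>verts G. (mdist ?X (f u) (f v))\<^sup>2)
        \<le> (\<Sum>u\<in>verts G. \<Sum>v\<in>verts G. ?D\<^sup>2)"
      using HD fH by (intro sum_mono power_mono) auto
    then show "P f \<le> (real n)\<^sup>2 * ?D\<^sup>2 / 2"
      by (simp add: P_def assms(4) power2_eq_square)
  qed

  have gap_pos: "0 < spectral_gap G ?X"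
  proof -
    \<comment> \<open>An infimum of positive numbers may be zero, so a uniform bound is needed: the
      energy is at least 1 and \<open>P f\<close> is at most \<open>n^2 * D^2 / 2\<close>.\<close>
    let ?c = "n / (k * ((real n)\<^sup>2 * ?D\<^sup>2 / 2))"
    have "?c \<le> rayleigh G ?X f" if f: "f \<in> F" for f
      unfolding R
    proof (rule frac_le)
      show "real n \<le> n * edge_energy G ?X f"
        using energy[OF f] by (simp add: mult_le_cancel_left1)
      show "k * P f \<le> k * ((real n)\<^sup>2 * ?D\<^sup>2 / 2)"
        using P_le[OF f] by (intro mult_left_mono) auto
      show "0 \<le> n * edge_energy G ?X f" by (simp add: edge_energy_nonneg)
      show "0 < k * P f" using P_pos[OF f] k by simp
    qed
    then have "?c \<le> spectral_gap G ?X"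
      unfolding gap using \<open>F \<noteq> {}\<close> by (intro cINF_greatest)
    moreover have "0 < ?c" using n k D by simp
    ultimately show ?thesis by linarith
  qed

  \<comment> \<open>The two bounds on the ratio of the gaps\<close>
  let ?q = "real k / (real k + 1)" and ?C = "1 + real n * ?D\<^sup>2 / 2"
  \<comment> \<open>Over the denominator of \<open>G\<close>, the quotients differ in the edge
    energy and the factor \<open>?q\<close> alone.\<close>
  have ratio: "rayleigh G' ?X f = ?q * (n * edge_energy G' ?X f / (k * P f))" for f
    unfolding R' times_divide_times_eq mult.left_commute[of _ "real k" "P f"]
    using k by (simp add: add.commute)
  have lower: "?q * spectral_gap G ?X \<le> spectral_gap G' ?X"
    unfolding gap'
  proof (rule cINF_greatest[OF \<open>F \<noteq> {}\<close>])
    fix f assume f: "f \<in> F"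
    have "spectral_gap G ?X \<le> rayleigh G ?X f"
      using f PE by (intro spectral_gap_le_rayleigh) (auto simp: F_def)
    also have "\<dots> \<le> n * edge_energy G' ?X f / (k * P f)"
      unfolding R using P_pos[OF f] edge_energy_mono[OF sub]
      by (intro divide_right_mono mult_left_mono) auto
    finally show "?q * spectral_gap G ?X \<le> rayleigh G' ?X f"
      unfolding ratio by (intro mult_left_mono) auto
  qed
  \<comment> \<open>By the volumes, \<open>(k + 1) * n - k * n\<close> arcs are added, that is,
    \<open>n / 2\<close> edges.\<close>
  have "card (arcs G' - arcs G) = n"
  proof -
    have "arcs G \<subseteq> arcs G'" using sub by (auto simp: subgraph_def)
    then show ?thesis
      using vol_regular[OF assms(3)] vol_regular[OF assms(6)]
      by (simp add: card_Diff_subset G.card_arcs_eq_vol G'.card_arcs_eq_vol vG assms(4))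
  qed
  note extra = edge_energy_le_add[OF sub G'.wf_digraph_axioms G'.finite_arcs, of ?X _ ?D,
      unfolded this]
  have qC_pos: "0 < ?q * ?C" using k by (intro mult_pos_pos add_pos_nonneg) auto
  \<comment> \<open>With the constant moved to the left, the claim is a lower bound on every
    quotient of \<open>G\<close> and passes to their infimum.\<close>
  have upper: "spectral_gap G' ?X / (?q * ?C) \<le> spectral_gap G ?X"
    unfolding gap
  proof (rule cINF_greatest[OF \<open>F \<noteq> {}\<close>])
    fix f assume f: "f \<in> F"
    have "edge_energy G' ?X f \<le> edge_energy G ?X f + n * ?D\<^sup>2 / 2"
      using f vG by (intro extra HD) (auto simp: F_def)
    \<comment> \<open>Energy at least 1 turns the additive error into a multiplicative one.\<close>
    also have "\<dots> \<le> edge_energy G ?X f + (n * ?D\<^sup>2 / 2) * edge_energy G ?X f"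
      using mult_left_mono[OF energy[OF f], of "n * ?D\<^sup>2 / 2"] by simp
    also have "\<dots> = ?C * edge_energy G ?X f" by (simp add: algebra_simps)
    finally have E: "edge_energy G' ?X f \<le> ?C * edge_energy G ?X f" .
    have "spectral_gap G' ?X \<le> rayleigh G' ?X f"
      using f PE' vG by (intro spectral_gap_le_rayleigh) (auto simp: F_def)
    also have "\<dots> \<le> ?q * (n * (?C * edge_energy G ?X f) / (k * P f))"
      unfolding ratio using P_pos[OF f] E
      by (intro mult_left_mono divide_right_mono) auto
    also have "\<dots> = rayleigh G ?X f * (?q * ?C)" unfolding R by (simp add: mult_ac)
    finally show "spectral_gap G' ?X / (?q * ?C) \<le> rayleigh G ?X f"
      using qC_pos by (simp only: pos_divide_le_eq)
  qed
  from upper qC_pos have "spectral_gap G' ?X \<le> ?q * ?C * spectral_gap G ?X"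
    by (simp only: pos_divide_le_eq mult.commute)
  with lower gap_pos show ?thesis
    by (simp only: pos_le_divide_eq pos_divide_le_eq simp_thms)
qed

end
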